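(* Let $n\ge 1$, let $0\le \mu_1\le \mu_2\le\cdots\le\mu_n$ be real numbers, and let $X_1,\dots,X_n$ be independent non-negative random variables with $\mathbb{E}[X_i]=\mu_i$ for each $i\in\{1,\dots,n\}$. Then for every $\delta>0$, $$\mathbb{P}\left(\sum_{i=1}^n X_i<\delta+\sum_{i=1}^n\mu_i\right)\ \ge\ \min_{1\le i\le n}\ \prod_{j=i}^n\left(1-\frac{\mu_j}{\delta+\sum_{k=i}^n\mu_k}\right).$$
   Context: All random variables are real-valued. The $X_i$ are arbitrary (not necessarily discrete). *)

theory Defs
  imports "HOL-Probability.Probability"
begin

end

theory Submission
  imports Defs
begin

text \<open>For fixed distributions of all variables but one, the probability is an expectation of a
  function of the remaining variable, so it is enough to consider variables with two values
  (\<open>expectation_ge_two_point\<close>, \<open>prob_ge_two_point\<close>). Subtracting their smaller values, which lowers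
  the means and the threshold alike and keeps the slack \<open>\<delta>\<close>, leaves a sum \<open>S\<close> of independent
  variables with values \<open>0\<close> and \<open>b i\<close>, and a threshold \<open>T = \<delta> + E S\<close>.

  The parameter that governs the problem is the mean distance \<open>m = E (T - S | S < T)\<close>. In the
  extremal examples some variables are constant and the others, of means \<open>y i\<close>, take the values
  \<open>0\<close> and \<open>m\<close>, where \<open>m = \<delta> + (\<Sum>i. y i)\<close>; the probability is then \<open>\<Prod>i. 1 - y i / m\<close>. In general it is
  at least such a product, with \<open>y i\<close> between \<open>0\<close> and the mean of the \<open>i\<close>-th variable
  (\<open>below_ge_prod\<close>). The reason is that some variable has nonnegative covariance with \<open>S\<close> under the
  condition \<open>S < T\<close>, because all these covariances add up to a variance. Deleting such a variable
  does not decrease the mean distance (\<open>ex_delete_mean_gap_ge\<close>), and the value of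
  \<open>E (T - S)\<^sup>+\<close> before the deletion is at least \<open>1 - x / m\<close> times the value after it, where \<open>x\<close> is
  the mean of the deleted variable. Iterating this, and using
  Markov's inequality for the variables that are left when the slack reaches \<open>m\<close>, gives the
  product (\<open>gap_ge_prod\<close>).

  It remains to minimise \<open>\<Prod>i. 1 - y i / (\<delta> + (\<Sum>k. y k))\<close> over all \<open>y\<close> with \<open>0 \<le> y i \<le> \<mu> i\<close>. This
  function first increases and then decreases in each coordinate, so the minimum is attained at a
  vertex of the box, and an exchange argument moves the vertex to one that is supported on a
  suffix of the sorted means (\<open>kill_prod_ge_subset\<close>, \<open>kill_prod_ge_suffix\<close>).\<close>

section \<open>Random subsets with independent memberships\<close>

text \<open>The expectation of \<open>F\<close> at a random subset of \<open>N\<close> that contains each \<open>i\<close> independently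
  with probability \<open>p i\<close>. Sums of independent two-valued variables live on this finite model.\<close>

definition bexp :: "('i \<Rightarrow> real) \<Rightarrow> 'i set \<Rightarrow> ('i set \<Rightarrow> real) \<Rightarrow> real" where
  "bexp p N F = (\<Sum>A\<in>Pow N. (\<Prod>i\<in>A. p i) * (\<Prod>i\<in>N - A. 1 - p i) * F A)"

lemma bexp_empty [simp]: "bexp p {} F = F {}"
  by (simp add: bexp_def)

lemma bexp_insert:
  assumes "finite N" "i \<notin> N"
  shows "bexp p (insert i N) F
    = (1 - p i) * bexp p N F + p i * bexp p N (\<lambda>A. F (insert i A))"
proof -
  let ?w = "\<lambda>A. (\<Prod>j\<in>A. p j) * (\<Prod>j\<in>insert i N - A. 1 - p j) * F A"
  have inj: "inj_on (insert i) (Pow N)"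
    using assms(2) by (auto simp: inj_on_def)
  have "bexp p (insert i N) F = sum ?w (Pow N) + sum ?w (insert i ` Pow N)"
    unfolding bexp_def Pow_insert
    by (rule sum.union_disjoint) (use assms in auto)
  moreover have "sum ?w (Pow N) = (1 - p i) * bexp p N F"
    unfolding bexp_def sum_distrib_left
  proof (rule sum.cong)
    fix A assume A: "A \<in> Pow N"
    then have "insert i N - A = insert i (N - A)" using assms(2) by auto
    then show "?w A = (1 - p i) * ((\<Prod>j\<in>A. p j) * (\<Prod>j\<in>N - A. 1 - p j) * F A)"
      using assms by (simp add: mult_ac)
  qed simp
  moreover have "sum ?w (insert i ` Pow N) = p i * bexp p N (\<lambda>A. F (insert i A))"
    unfolding bexp_def sum_distrib_left sum.reindex[OF inj] o_def
  proof (rule sum.cong)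
    fix A assume A: "A \<in> Pow N"
    then have "insert i N - insert i A = N - A" "finite A" "i \<notin> A"
      using assms by (auto intro: finite_subset)
    then show "?w (insert i A)
        = p i * ((\<Prod>j\<in>A. p j) * (\<Prod>j\<in>N - A. 1 - p j) * F (insert i A))"
      by (simp add: mult_ac)
  qed simp
  ultimately show ?thesis by simp
qed

lemma bexp_cong: "(\<And>A. A \<subseteq> N \<Longrightarrow> F A = G A) \<Longrightarrow> bexp p N F = bexp p N G"
  by (simp add: bexp_def)

lemma bexp_mono:
  assumes "\<And>i. i \<in> N \<Longrightarrow> 0 \<le> p i \<and> p i < 1" "\<And>A. A \<subseteq> N \<Longrightarrow> F A \<le> G A"
  shows "bexp p N F \<le> bexp p N G"
  unfolding bexp_def
  by (intro sum_mono mult_left_mono mult_nonneg_nonneg prod_nonneg)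
     (use assms in \<open>auto simp: less_imp_le subset_iff\<close>)

lemma bexp_add: "bexp p N (\<lambda>A. F A + G A) = bexp p N F + bexp p N G"
  by (simp add: bexp_def algebra_simps sum.distrib)

lemma bexp_cmult: "bexp p N (\<lambda>A. c * F A) = c * bexp p N F"
  by (simp add: bexp_def sum_distrib_left mult_ac)

lemma bexp_sum: "bexp p N (\<lambda>A. \<Sum>i\<in>I. F i A) = (\<Sum>i\<in>I. bexp p N (F i))"
  unfolding bexp_def sum_distrib_left by (rule sum.swap)

lemma bexp_const:
  assumes "finite N" shows "bexp p N (\<lambda>_. c) = c"
  using assms by induction (simp_all add: bexp_insert algebra_simps)

lemma bexp_delete:
  assumes "finite N" "i \<in> N"
  shows "bexp p N F
    = (1 - p i) * bexp p (N - {i}) F + p i * bexp p (N - {i}) (\<lambda>A. F (insert i A))"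
  using bexp_insert[of "N - {i}" i p F] assms by (simp add: insert_absorb)

text \<open>Size biasing: weighting by one summand of \<open>sum b A\<close> forces the corresponding index into
  the random set and leaves the other indices as they were.\<close>

lemma bexp_sum_weight:
  assumes N: "finite N"
  shows "bexp p N (\<lambda>A. sum b A * F A)
    = (\<Sum>i\<in>N. p i * b i * bexp p (N - {i}) (\<lambda>A. F (insert i A)))"
proof -
  have "bexp p N (\<lambda>A. sum b A * F A)
      = bexp p N (\<lambda>A. \<Sum>i\<in>N. (if i \<in> A then b i * F A else 0))"
  proof (rule bexp_cong)
    fix A assume "A \<subseteq> N"
    then have "sum b A = (\<Sum>i\<in>N. if i \<in> A then b i else 0)"
      using N by (simp add: sum.inter_restrict[symmetric] Int_absorb1)
    then show "sum b A * F A = (\<Sum>i\<in>N. (if i \<in> A then b i * F A else 0))"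
      by (simp add: sum_distrib_right if_distrib[of "\<lambda>x. x * F A"] cong: if_cong)
  qed
  also have "\<dots> = (\<Sum>i\<in>N. bexp p N (\<lambda>A. if i \<in> A then b i * F A else 0))"
    by (rule bexp_sum)
  also have "\<dots> = (\<Sum>i\<in>N. p i * b i * bexp p (N - {i}) (\<lambda>A. F (insert i A)))"
  proof (rule sum.cong)
    fix i assume i: "i \<in> N"
    have "bexp p (N - {i}) (\<lambda>A. if i \<in> A then b i * F A else 0) = bexp p (N - {i}) (\<lambda>A. 0)"
      by (rule bexp_cong) auto
    then show "bexp p N (\<lambda>A. if i \<in> A then b i * F A else 0)
        = p i * b i * bexp p (N - {i}) (\<lambda>A. F (insert i A))"
      using N by (simp add: bexp_delete[OF N i] bexp_const bexp_cmult)
  qed simp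
  finally show ?thesis .
qed

section \<open>Distance of a sum to a threshold\<close>

text \<open>With \<open>S = sum b A\<close> for the random set \<open>A\<close>, the two quantities below are \<open>P(S < T)\<close> and
  \<open>E (T - S)\<^sup>+\<close>; their quotient \<open>gap / below\<close> is the mean distance \<open>E (T - S | S < T)\<close> to the
  threshold.\<close>

definition below :: "('i \<Rightarrow> real) \<Rightarrow> ('i \<Rightarrow> real) \<Rightarrow> real \<Rightarrow> 'i set \<Rightarrow> real" where
  "below p b T N = bexp p N (\<lambda>A. if sum b A < T then 1 else 0)"

definition gap :: "('i \<Rightarrow> real) \<Rightarrow> ('i \<Rightarrow> real) \<Rightarrow> real \<Rightarrow> 'i set \<Rightarrow> real" where
  "gap p b T N = bexp p N (\<lambda>A. max 0 (T - sum b A))"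

context
  fixes p b :: "'i \<Rightarrow> real" and N :: "'i set"
  assumes fin: "finite N"
    and p: "\<And>i. i \<in> N \<Longrightarrow> 0 \<le> p i \<and> p i < 1"
    and b: "\<And>i. i \<in> N \<Longrightarrow> 0 \<le> b i"
begin

text \<open>Together with \<open>gap_le\<close> this is Markov's inequality for \<open>P(S \<ge> T)\<close>.\<close>

lemma gap_ge: "T - (\<Sum>i\<in>N. p i * b i) \<le> gap p b T N"
proof -
  have "T - (\<Sum>i\<in>N. p i * b i) = bexp p N (\<lambda>A. T + (-1) * (sum b A * 1))"
    unfolding bexp_add bexp_cmult bexp_sum_weight[OF fin] by (simp add: bexp_const fin)
  also have "\<dots> \<le> gap p b T N"
    unfolding gap_def by (rule bexp_mono) (use p in auto)
  finally show ?thesis .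
qed

lemma gap_le: "0 \<le> T \<Longrightarrow> gap p b T N \<le> T * below p b T N"
  unfolding gap_def below_def bexp_cmult[symmetric]
  by (rule bexp_mono) (use p b in \<open>auto intro!: sum_nonneg\<close>)

lemma below_le_1: "below p b T N \<le> 1"
proof -
  have "below p b T N \<le> bexp p N (\<lambda>_. 1)"
    unfolding below_def by (rule bexp_mono) (use p in auto)
  then show ?thesis by (simp add: bexp_const fin)
qed

lemma below_mono_delete:
  assumes i: "i \<in> N"
  shows "below p b T N \<le> below p b T (N - {i})"
proof -
  have "bexp p (N - {i}) (\<lambda>A. if sum b (insert i A) < T then 1 else 0)
      \<le> bexp p (N - {i}) (\<lambda>A. if sum b A < T then 1 else 0)"
  proof (rule bexp_mono)
    fix A assume "A \<subseteq> N - {i}"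
    then have "sum b (insert i A) = b i + sum b A"
      using fin finite_subset by (subst sum.insert) auto
    then show "(if sum b (insert i A) < T then 1 else (0::real)) \<le> (if sum b A < T then 1 else 0)"
      using b[OF i] by auto
  qed (use p in auto)
  then show ?thesis
    using p[OF i] unfolding below_def bexp_delete[OF fin i]
    by (simp add: algebra_simps mult_left_mono)
qed

text \<open>The positive part \<open>(T - S)\<^sup>+\<close> is convex in \<open>S\<close> with slope at least \<open>-1\<close>, and slope \<open>0\<close> beyond
  the threshold, so adding an independent summand of mean \<open>x\<close> to \<open>S\<close> costs at most
  \<open>x * P(S < T)\<close>.\<close>

lemma gap_delete:
  assumes i: "i \<in> N"
  shows "gap p b T (N - {i}) - p i * b i * below p b T (N - {i}) \<le> gap p b T N"
proof -
  let ?d = "\<lambda>A. max 0 (T - sum b A)" and ?l = "\<lambda>A. if sum b A < T then 1 else (0::real)"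
  have "bexp p (N - {i}) (\<lambda>A. ?d A + (- b i) * ?l A) \<le> bexp p (N - {i}) (\<lambda>A. ?d (insert i A))"
  proof (rule bexp_mono)
    fix A assume "A \<subseteq> N - {i}"
    then have "sum b (insert i A) = b i + sum b A"
      using fin finite_subset by (subst sum.insert) auto
    then show "?d A + (- b i) * ?l A \<le> ?d (insert i A)"
      using b[OF i] by auto
  qed (use p in auto)
  then have "p i * (gap p b T (N - {i}) - b i * below p b T (N - {i}))
      \<le> p i * bexp p (N - {i}) (\<lambda>A. ?d (insert i A))"
    using p[OF i] unfolding bexp_add bexp_cmult gap_def below_def
    by (intro mult_left_mono) auto
  then show ?thesis
    unfolding gap_def bexp_delete[OF fin i] by (simp add: algebra_simps)
qed

text \<open>The step that makes the induction on the number of summands possible. Let \<open>m\<close> be the mean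
  distance to the threshold. Conditioned on \<open>S < T\<close>, the covariances of \<open>S\<close> with its summands add
  up to the variance of \<open>S\<close>, which is nonnegative, so one of them is nonnegative. For a
  two-valued summand this means that conditioning on the value \<open>0\<close>, which has positive probability
  because \<open>p i < 1\<close>, does not decrease the mean distance: deleting that summand keeps the mean distance at least \<open>m\<close>.\<close>

lemma ex_delete_mean_gap_ge:
  assumes ne: "N \<noteq> {}" and pos: "0 < below p b T N"
    and M: "gap p b T N = m * below p b T N"
  shows "\<exists>i\<in>N. m * below p b T (N - {i}) \<le> gap p b T (N - {i})"
proof -
  \<comment> \<open>\<open>k\<close> is the centred distance \<open>T - S - m\<close>, restricted to the event \<open>S < T\<close>.\<close>
  define k where "k A = max 0 (T - sum b A) + (- m) * (if sum b A < T then 1 else 0)" for A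
  have Ek: "bexp p K k = gap p b T K - m * below p b T K" for K
    unfolding k_def bexp_add bexp_cmult gap_def below_def by simp
  have 0: "bexp p N k = 0" using Ek M by simp
  have "bexp p N (\<lambda>A. sum b A * k A) \<le> bexp p N (\<lambda>A. (T - m) * k A)"
  proof (rule bexp_mono)
    fix A
    show "sum b A * k A \<le> (T - m) * k A"
    proof (cases "sum b A < T")
      case True
      then have "(T - m) * k A - sum b A * k A = (T - sum b A - m)\<^sup>2"
        by (simp add: k_def power2_eq_square algebra_simps)
      then show ?thesis by (metis diff_ge_0_iff_ge zero_le_power2)
    qed (simp add: k_def)
  qed (use p in auto)
  then have "(\<Sum>i\<in>N. p i * b i * bexp p (N - {i}) (\<lambda>A. k (insert i A))) \<le> 0"
    unfolding bexp_cmult bexp_sum_weight[OF fin] using 0 by simp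
  then obtain i where i: "i \<in> N" "p i * b i * bexp p (N - {i}) (\<lambda>A. k (insert i A)) \<le> 0"
    using sum_pos[OF fin ne] by (meson not_le)
  have split: "(1 - p i) * bexp p (N - {i}) k + p i * bexp p (N - {i}) (\<lambda>A. k (insert i A)) = 0"
    using 0 bexp_delete[OF fin i(1)] by metis
  have "0 \<le> bexp p (N - {i}) k"
  proof (cases "b i = 0")
    case True
    have "bexp p (N - {i}) (\<lambda>A. k (insert i A)) = bexp p (N - {i}) k"
    proof (rule bexp_cong)
      fix A assume "A \<subseteq> N - {i}"
      then have "sum b (insert i A) = sum b A"
        using fin finite_subset True by (subst sum.insert) auto
      then show "k (insert i A) = k A" by (simp add: k_def)
    qed
    then show ?thesis using split by (simp add: algebra_simps)
  next
    case False
    then have "p i * bexp p (N - {i}) (\<lambda>A. k (insert i A)) \<le> 0"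
      using i b[OF i(1)] by (smt (verit) mult.assoc mult.commute mult_le_0_iff)
    then have "0 \<le> (1 - p i) * bexp p (N - {i}) k" using split by linarith
    then show ?thesis using p[OF i(1)] by (simp add: zero_le_mult_iff)
  qed
  then show ?thesis using Ek i by auto
qed

end

text \<open>Delete one summand after the other, each time one for which the mean distance to the threshold
  stays at least \<open>m\<close>. If the deleted summand has mean \<open>x\<close>, the gap with it is at least
  \<open>1 - x / m\<close> times the gap without it, and the deletion raises the slack \<open>T - E S\<close> by \<open>x\<close>. The process stops when the slack is about
  to exceed \<open>m\<close>; there Markov's inequality, applied to the remaining summands, provides the last
  factor. The numbers \<open>y i\<close> record this: the full mean for the deleted summands, the missing
  slack for one summand, and \<open>0\<close> for the others. Since the deleted summands are dictated by the
  distribution, only the total of the \<open>y i\<close> is known. The parameter \<open>m\<close> stays fixed during the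
  induction while the mean distance of the remaining summands may grow.\<close>

lemma gap_ge_prod:
  fixes p b :: "'i \<Rightarrow> real"
  assumes "finite N" "\<And>i. i \<in> N \<Longrightarrow> 0 \<le> p i \<and> p i < 1" "\<And>i. i \<in> N \<Longrightarrow> 0 \<le> b i"
    and "0 < m" "0 < below p b T N" "m * below p b T N \<le> gap p b T N"
    and "0 < T - (\<Sum>i\<in>N. p i * b i)" "T - (\<Sum>i\<in>N. p i * b i) \<le> m"
  shows "\<exists>y. (\<forall>i\<in>N. 0 \<le> y i \<and> y i \<le> p i * b i)
    \<and> (\<Sum>i\<in>N. y i) = m - (T - (\<Sum>i\<in>N. p i * b i))
    \<and> m * (\<Prod>i\<in>N. 1 - y i / m) \<le> gap p b T N"
  using assms
proof (induction "card N" arbitrary: N)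
  case 0
  then have N: "N = {}" by simp
  have T: "0 < T" "T \<le> m" using "0.prems"(7,8) by (simp_all add: N)
  have "m \<le> T" using "0.prems"(6) T(1) by (simp add: N below_def gap_def)
  then show ?case using T by (simp add: N gap_def)
next
  case (Suc c)
  note fin = Suc.prems(1) and p = Suc.prems(2) and b = Suc.prems(3)
  define M where "M = gap p b T N / below p b T N"
  define \<delta> where "\<delta> = T - (\<Sum>i\<in>N. p i * b i)"
  have M: "gap p b T N = M * below p b T N" "m \<le> M"
    using Suc.prems(5,6) by (auto simp: M_def field_simps)
  have "N \<noteq> {}" using Suc.hyps(2) by auto
  then obtain i where i: "i \<in> N" and iM: "M * below p b T (N - {i}) \<le> gap p b T (N - {i})"
    using ex_delete_mean_gap_ge[OF fin p b _ Suc.prems(5) M(1)] by blast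
  have x: "0 \<le> p i * b i" using p[OF i] b[OF i] by simp
  have sumi: "(\<Sum>j\<in>N. p j * b j) = p i * b i + (\<Sum>j\<in>N - {i}. p j * b j)"
    by (rule sum.remove[OF fin i])
  show ?case
  proof (cases "m - \<delta> \<le> p i * b i")
    case True
    let ?y = "\<lambda>j. if j = i then m - \<delta> else 0"
    have "(\<Prod>j\<in>N. 1 - ?y j / m) = (\<Prod>j\<in>N. if j = i then 1 - (m - \<delta>) / m else 1)"
      by (rule prod.cong) auto
    also have "\<dots> = 1 - (m - \<delta>) / m" using fin i by simp
    finally have "m * (\<Prod>j\<in>N. 1 - ?y j / m) = \<delta>"
      using Suc.prems(4) by (simp add: field_simps)
    then have 1: "m * (\<Prod>j\<in>N. 1 - ?y j / m) \<le> gap p b T N"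
      using gap_ge[where p = p and b = b and T = T, OF fin p b] by (simp add: \<delta>_def)
    have 2: "(\<Sum>j\<in>N. ?y j) = m - (T - (\<Sum>j\<in>N. p j * b j))"
      using fin i by (simp add: \<delta>_def)
    have 3: "\<forall>j\<in>N. 0 \<le> ?y j \<and> ?y j \<le> p j * b j"
      using True Suc.prems(8) p b by (auto simp: \<delta>_def)
    show ?thesis by (intro exI[of _ ?y] conjI 1 2 3)
  next
    case False
    let ?N = "N - {i}"
    have pos: "0 < below p b T ?N"
      using below_mono_delete[where p = p and b = b and T = T, OF fin p b i] Suc.prems(5) by linarith
    have le: "m * below p b T ?N \<le> gap p b T ?N"
      using iM M(2) pos by (meson less_imp_le mult_right_mono order_trans)
    have "\<exists>y. (\<forall>j\<in>?N. 0 \<le> y j \<and> y j \<le> p j * b j)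
        \<and> (\<Sum>j\<in>?N. y j) = m - (T - (\<Sum>j\<in>?N. p j * b j))
        \<and> m * (\<Prod>j\<in>?N. 1 - y j / m) \<le> gap p b T ?N"
    proof (rule Suc.hyps(1))
      show "c = card ?N" using Suc.hyps(2) fin i by simp
      show "0 < T - (\<Sum>j\<in>?N. p j * b j)" using Suc.prems(7) sumi x by linarith
      show "T - (\<Sum>j\<in>?N. p j * b j) \<le> m" using False sumi by (simp add: \<delta>_def)
    qed (use fin p b Suc.prems(4) pos le in auto)
    then obtain y where y: "\<And>j. j \<in> ?N \<Longrightarrow> 0 \<le> y j \<and> y j \<le> p j * b j"
      "(\<Sum>j\<in>?N. y j) = m - (T - (\<Sum>j\<in>?N. p j * b j))"
      "m * (\<Prod>j\<in>?N. 1 - y j / m) \<le> gap p b T ?N" by blast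
    let ?y = "y(i := p i * b i)"
    have r: "0 \<le> 1 - p i * b i / m"
      using False Suc.prems(4,7) by (simp add: \<delta>_def field_simps)
    have "(\<Prod>j\<in>N. 1 - ?y j / m) = (1 - p i * b i / m) * (\<Prod>j\<in>?N. 1 - y j / m)"
      by (subst prod.remove[OF fin i]) (auto intro!: prod.cong)
    then have "m * (\<Prod>j\<in>N. 1 - ?y j / m)
        = (1 - p i * b i / m) * (m * (\<Prod>j\<in>?N. 1 - y j / m))" by simp
    also have "\<dots> \<le> (1 - p i * b i / m) * gap p b T ?N"
      by (rule mult_left_mono[OF y(3) r])
    also have "\<dots> = gap p b T ?N - p i * b i * (gap p b T ?N / m)"
      by (simp add: algebra_simps)
    also have "\<dots> \<le> gap p b T ?N - p i * b i * below p b T ?N"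
      using le Suc.prems(4) x by (intro diff_left_mono mult_left_mono) (auto simp: field_simps)
    also have "\<dots> \<le> gap p b T N" by (rule gap_delete[where p = p and b = b and T = T, OF fin p b i])
    finally have 1: "m * (\<Prod>j\<in>N. 1 - ?y j / m) \<le> gap p b T N" .
    have "(\<Sum>j\<in>N. ?y j) = p i * b i + (\<Sum>j\<in>?N. y j)"
      by (subst sum.remove[OF fin i]) (auto intro!: sum.cong)
    then have 2: "(\<Sum>j\<in>N. ?y j) = m - (T - (\<Sum>j\<in>N. p j * b j))"
      using y(2) sumi by simp
    have 3: "\<forall>j\<in>N. 0 \<le> ?y j \<and> ?y j \<le> p j * b j" using y(1) x by auto
    show ?thesis by (intro exI[of _ ?y] conjI 1 2 3)
  qed
qed

text \<open>The probability that independent variables with means \<open>y i\<close>, each taking only the values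
  \<open>0\<close> and \<open>\<delta> + (\<Sum>k\<in>N. y k)\<close>, all vanish. For suffixes of \<open>\<mu>\<close> these are the products in the
  theorem.\<close>

definition kill_prod :: "real \<Rightarrow> ('i \<Rightarrow> real) \<Rightarrow> 'i set \<Rightarrow> real" where
  "kill_prod \<delta> y N = (\<Prod>i\<in>N. 1 - y i / (\<delta> + (\<Sum>k\<in>N. y k)))"

text \<open>Take \<open>m\<close> to be the mean distance \<open>E (T - S | S < T)\<close> itself. The total of the \<open>y i\<close> is then
  \<open>m - \<delta>\<close>, so that \<open>m\<close> is the denominator in \<^const>\<open>kill_prod\<close>.\<close>

lemma below_ge_prod:
  fixes p b :: "'i \<Rightarrow> real"
  assumes fin: "finite N" and p: "\<And>i. i \<in> N \<Longrightarrow> 0 \<le> p i \<and> p i < 1"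
    and b: "\<And>i. i \<in> N \<Longrightarrow> 0 \<le> b i"
    and \<delta>: "0 < \<delta>" and T: "T = \<delta> + (\<Sum>i\<in>N. p i * b i)"
  shows "\<exists>y. (\<forall>i\<in>N. 0 \<le> y i \<and> y i \<le> p i * b i)
    \<and> kill_prod \<delta> y N \<le> below p b T N"
proof -
  have T0: "0 \<le> T" using \<delta> p b by (auto simp: T intro!: add_nonneg_nonneg sum_nonneg)
  have g: "\<delta> \<le> gap p b T N" using gap_ge[where p = p and b = b and T = T, OF fin p b] by (simp add: T)
  with \<delta> have "0 < T * below p b T N" using gap_le[where p = p and b = b, OF fin p b T0] by linarith
  then have V: "0 < below p b T N" using T0 by (simp add: zero_less_mult_iff)
  define m where "m = gap p b T N / below p b T N"
  have m: "gap p b T N = m * below p b T N" using V by (simp add: m_def)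
  have m0: "0 < m" unfolding m_def using V g \<delta> by (intro divide_pos_pos) auto
  then have "m * below p b T N \<le> m"
    using below_le_1[where p = p and b = b and T = T, OF fin p b] by (simp add: mult_left_le)
  then have \<delta>m: "\<delta> \<le> m" using g m by linarith
  have eq: "T - (\<Sum>i\<in>N. p i * b i) = \<delta>" by (simp add: T)
  obtain y where y: "\<forall>i\<in>N. 0 \<le> y i \<and> y i \<le> p i * b i"
    "(\<Sum>i\<in>N. y i) = m - \<delta>" "m * (\<Prod>i\<in>N. 1 - y i / m) \<le> gap p b T N"
    using gap_ge_prod[OF fin p b m0 V, unfolded eq] \<delta> \<delta>m m by (metis order_refl)
  have "(\<Prod>i\<in>N. 1 - y i / m) \<le> below p b T N"
    using y(3) m0 unfolding m by simp
  then show ?thesis using y by (intro exI[of _ y]) (simp add: kill_prod_def)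
qed

section \<open>Minimising the product over a box\<close>

text \<open>The logarithmic derivative of \<open>h\<close> has the sign of \<open>(\<Sum>j\<in>J. y j / (c + t - y j)) - 1\<close>, which
  decreases in \<open>t\<close>: the function first increases and then decreases, so its minimum on an
  interval is attained at an end point.\<close>

lemma single_mean_unimodal:
  fixes y :: "'i \<Rightarrow> real"
  assumes fin: "finite J" and c: "0 < c" and y: "\<And>j. j \<in> J \<Longrightarrow> 0 \<le> y j \<and> y j < c"
    and t: "0 \<le> t" "t \<le> u"
  defines "h \<equiv> \<lambda>t. (1 - t / (c + t)) * (\<Prod>j\<in>J. 1 - y j / (c + t))"
  shows "min (h 0) (h u) \<le> h t"
proof -
  define l where "l t = ln c - ln (c + t) + (\<Sum>j\<in>J. ln (c + t - y j) - ln (c + t))" for t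
  define l' where "l' t = - 1 / (c + t) + (\<Sum>j\<in>J. 1 / (c + t - y j) - 1 / (c + t))" for t
  define s where "s t = (\<Sum>j\<in>J. y j / (c + t - y j))" for t
  have pos: "y j < c + t" if "j \<in> J" "0 \<le> t" for j t using y[OF that(1)] that(2) by simp
  have h: "h t = exp (l t)" if "0 \<le> t" for t
  proof -
    have "exp (l t) = c / (c + t) * (\<Prod>j\<in>J. (c + t - y j) / (c + t))"
      using c that by (simp add: l_def exp_add exp_diff exp_sum[OF fin] pos)
    also have "\<dots> = h t"
      unfolding h_def using c that
      by (intro arg_cong2[where f = "(*)"] prod.cong) (auto simp: field_simps)
    finally show ?thesis by simp
  qed
  have der: "(l has_real_derivative l' t) (at t)" if t: "0 \<le> t" for t
  proof -
    have 1: "((\<lambda>t. ln (c + t - z)) has_real_derivative 1 / (c + t - z)) (at t)" if "z < c + t" for z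
      using that by (auto intro!: derivative_eq_intros)
    have "(l has_real_derivative 0 - 1 / (c + t) + (\<Sum>j\<in>J. 1 / (c + t - y j) - 1 / (c + t))) (at t)"
      unfolding l_def using 1[of 0] 1[OF pos[OF _ t]] c t
      by (intro DERIV_add DERIV_diff DERIV_sum DERIV_const) auto
    then show ?thesis by (simp add: l'_def)
  qed
  have l': "l' t = (s t - 1) / (c + t)" if "0 \<le> t" for t
  proof -
    have "(\<Sum>j\<in>J. 1 / (c + t - y j) - 1 / (c + t)) = (\<Sum>j\<in>J. y j / (c + t - y j) / (c + t))"
    proof (rule sum.cong)
      fix j assume "j \<in> J"
      then show "1 / (c + t - y j) - 1 / (c + t) = y j / (c + t - y j) / (c + t)"
        using pos[OF _ that, of j] c that by (simp add: diff_frac_eq)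
    qed simp
    then show ?thesis by (simp add: l'_def s_def sum_divide_distrib diff_divide_distrib)
  qed
  have smono: "s v \<le> s t" if "0 \<le> t" "t \<le> v" for t v
    unfolding s_def using y pos that by (intro sum_mono divide_left_mono mult_pos_pos) force+
  have "l 0 \<le> l t \<or> l u \<le> l t"
  proof (cases "1 \<le> s t")
    case True
    have "l 0 \<le> l t"
    proof (rule DERIV_nonneg_imp_nondecreasing[OF t(1)])
      fix v assume v: "0 \<le> v" "v \<le> t"
      have "0 \<le> l' v" using l'[OF v(1)] smono[OF v] True c v by simp
      then show "\<exists>d. (l has_real_derivative d) (at v) \<and> 0 \<le> d" using der[OF v(1)] by blast
    qed
    then show ?thesis ..
  next
    case False
    have "l u \<le> l t"
    proof (rule DERIV_nonpos_imp_nonincreasing[OF t(2)])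
      fix v assume v: "t \<le> v" "v \<le> u"
      then have v0: "0 \<le> v" using t by simp
      have "l' v \<le> 0" using l'[OF v0] smono[OF t(1) v(1)] False c v0 by (simp add: divide_nonpos_pos)
      then show "\<exists>d. (l has_real_derivative d) (at v) \<and> d \<le> 0" using der[OF v0] by blast
    qed
    then show ?thesis ..
  qed
  then show ?thesis using t by (auto simp: h min_le_iff_disj)
qed

lemma kill_prod_unimodal:
  assumes fin: "finite N" and i: "i \<in> N" and \<delta>: "0 < \<delta>"
    and y: "\<And>j. j \<in> N \<Longrightarrow> 0 \<le> y j" and u: "y i \<le> u"
  shows "min (kill_prod \<delta> (y(i := 0)) N) (kill_prod \<delta> (y(i := u)) N) \<le> kill_prod \<delta> y N"
proof -
  let ?J = "N - {i}"
  let ?c = "\<delta> + sum y ?J"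
  have "kill_prod \<delta> (y(i := t)) N
      = (1 - t / (?c + t)) * (\<Prod>j\<in>?J. 1 - y j / (?c + t))" for t
  proof -
    have "(\<Sum>j\<in>N. (y(i := t)) j) = t + sum y ?J"
      by (subst sum.remove[OF fin i]) (auto intro!: sum.cong)
    then show ?thesis
      unfolding kill_prod_def
      by (subst prod.remove[OF fin i]) (auto intro!: prod.cong simp: add_ac)
  qed
  note eq = this
  have "y j < ?c" if "j \<in> ?J" for j
    using member_le_sum[of j ?J y] that y fin \<delta> by force
  moreover have "0 < ?c" using y \<delta> by (intro add_pos_nonneg sum_nonneg) auto
  ultimately have "min (kill_prod \<delta> (y(i := 0)) N) (kill_prod \<delta> (y(i := u)) N)
      \<le> kill_prod \<delta> (y(i := y i)) N"
    unfolding eq using y i u fin by (intro single_mean_unimodal) auto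
  then show ?thesis by simp
qed

lemma kill_prod_restrict:
  assumes "finite N" "I \<subseteq> N"
  shows "kill_prod \<delta> (\<lambda>i. if i \<in> I then y i else 0) N = kill_prod \<delta> y I"
proof -
  have "(\<Sum>k\<in>N. if k \<in> I then y k else 0) = sum y I"
    using assms by (simp add: sum.inter_restrict[symmetric] Int_absorb1)
  moreover have "(\<Prod>i\<in>N. 1 - (if i \<in> I then y i else 0) / s) = (\<Prod>i\<in>I. 1 - y i / s)" for s
    using assms by (intro prod.mono_neutral_cong_right) auto
  ultimately show ?thesis by (simp add: kill_prod_def)
qed

text \<open>Coordinate by coordinate, unimodality moves each \<open>y i\<close> to \<open>0\<close> or to \<open>\<mu> i\<close>.\<close>

lemma kill_prod_ge_subset:
  assumes fin: "finite N" and \<delta>: "0 < \<delta>" and y: "\<And>i. i \<in> N \<Longrightarrow> 0 \<le> y i \<and> y i \<le> \<mu> i"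
  shows "\<exists>I\<subseteq>N. kill_prod \<delta> \<mu> I \<le> kill_prod \<delta> y N"
proof -
  have "\<exists>I\<subseteq>N. kill_prod \<delta> \<mu> I \<le> kill_prod \<delta> y N"
    if "finite K" "K \<subseteq> N" "\<And>i. i \<in> N \<Longrightarrow> 0 \<le> y i \<and> y i \<le> \<mu> i"
      "\<And>i. i \<in> N - K \<Longrightarrow> y i = 0 \<or> y i = \<mu> i" for K y
    using that
  proof (induction K arbitrary: y)
    case empty
    let ?I = "{i \<in> N. y i = \<mu> i}"
    have "kill_prod \<delta> y N = kill_prod \<delta> (\<lambda>i. if i \<in> ?I then \<mu> i else 0) N"
      unfolding kill_prod_def using empty.prems(3)
      by (intro prod.cong refl arg_cong2[where f = "(-)"] arg_cong2[where f = "(/)"]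
            arg_cong2[where f = "(+)"] sum.cong) auto
    also have "\<dots> = kill_prod \<delta> \<mu> ?I" using fin by (intro kill_prod_restrict) auto
    finally show ?case by (intro exI[of _ ?I]) auto
  next
    case (insert i K)
    have IH: "\<exists>I\<subseteq>N. kill_prod \<delta> \<mu> I \<le> kill_prod \<delta> (y(i := v)) N" if "v = 0 \<or> v = \<mu> i" for v
    proof (rule insert.IH)
      fix j assume "j \<in> N"
      then show "0 \<le> (y(i := v)) j \<and> (y(i := v)) j \<le> \<mu> j"
        using insert.prems(2)[of j] that by auto
    next
      fix j assume "j \<in> N - K"
      then show "(y(i := v)) j = 0 \<or> (y(i := v)) j = \<mu> j"
        using insert.prems(3)[of j] that by auto
    qed (use insert.prems in auto)
    have "min (kill_prod \<delta> (y(i := 0)) N) (kill_prod \<delta> (y(i := \<mu> i)) N) \<le> kill_prod \<delta> y N"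
      using insert.prems by (intro kill_prod_unimodal fin \<delta>) auto
    then show ?case using IH[of 0] IH[of "\<mu> i"] by (meson min_le_iff_disj order_trans)
  qed
  from this[OF fin subset_refl y] show ?thesis by auto
qed

text \<open>If \<open>I\<close> contains \<open>i\<close> but not some \<open>j > i\<close>, then \<open>\<mu> i\<close> lies between \<open>0\<close> and \<open>\<mu> j\<close>; by
  unimodality, at least one of two changes, dropping \<open>i\<close> from \<open>I\<close> or replacing it by \<open>j\<close>, does not
  increase the product. Both changes lower \<open>\<Sum>i\<in>I. Suc n - i\<close>, so repeating them ends in a suffix or in
  the empty set, whose product \<open>1\<close> is at least that of \<open>{n..n}\<close>.\<close>

lemma kill_prod_ge_suffix:
  fixes \<mu> :: "nat \<Rightarrow> real"
  assumes n: "1 \<le> n" and \<delta>: "0 < \<delta>" and \<mu>: "\<And>i. i \<in> {1..n} \<Longrightarrow> 0 \<le> \<mu> i"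
    and mono: "\<And>i j. 1 \<le> i \<Longrightarrow> i \<le> j \<Longrightarrow> j \<le> n \<Longrightarrow> \<mu> i \<le> \<mu> j"
    and I: "I \<subseteq> {1..n}"
  shows "\<exists>i\<in>{1..n}. kill_prod \<delta> \<mu> {i..n} \<le> kill_prod \<delta> \<mu> I"
  using I
proof (induction "\<Sum>i\<in>I. Suc n - i" arbitrary: I rule: less_induct)
  case less
  have fin: "finite I" using less.prems finite_subset by blast
  show ?case
  proof (cases "\<exists>i\<in>I. \<exists>j\<in>{1..n} - I. i < j")
    case False
    show ?thesis
    proof (cases "I = {}")
      case True
      have "0 \<le> \<mu> n" using \<mu> n by simp
      then have "kill_prod \<delta> \<mu> {n..n} \<le> 1" using \<delta> by (simp add: kill_prod_def)
      then show ?thesis using True n by (intro bexI[of _ n]) (auto simp: kill_prod_def)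
    next
      case ne: False
      have "{Min I..n} \<subseteq> I"
      proof
        fix j assume j: "j \<in> {Min I..n}"
        show "j \<in> I"
        proof (rule ccontr)
          assume nj: "j \<notin> I"
          have "Min I \<in> I" using fin ne by simp
          with nj j less.prems have "Min I < j" "j \<in> {1..n} - I"
            by (auto simp: order.order_iff_strict)
          with False \<open>Min I \<in> I\<close> show False by blast
        qed
      qed
      moreover have "I \<subseteq> {Min I..n}" using fin less.prems by auto
      moreover have "Min I \<in> {1..n}" using Min_in[OF fin ne] less.prems by blast
      ultimately show ?thesis by (intro bexI[of _ "Min I"]) auto
    qed
  next
    case True
    then obtain i j where ij: "i \<in> I" "j \<in> {1..n}" "j \<notin> I" "i < j" by blast
    let ?S = "\<lambda>I. \<Sum>i\<in>I. Suc n - i"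
    let ?J = "insert j (I - {i})"
    \<comment> \<open>In \<open>?y\<close> the mean \<open>\<mu> i\<close> sits at position \<open>j\<close>, where it can be moved to \<open>0\<close> or \<open>\<mu> j\<close>.\<close>
    let ?y = "\<mu>(j := \<mu> i)"
    have "kill_prod \<delta> (?y(j := 0)) ?J
        = kill_prod \<delta> (\<lambda>k. if k \<in> I - {i} then \<mu> k else 0) ?J"
    proof -
      have eq: "(?y(j := 0)) k = (if k \<in> I - {i} then \<mu> k else 0)" if "k \<in> ?J" for k
        using that ij by auto
      have "sum (?y(j := 0)) ?J = (\<Sum>k\<in>?J. if k \<in> I - {i} then \<mu> k else 0)"
        by (rule sum.cong[OF refl eq])
      then show ?thesis
        unfolding kill_prod_def by (intro prod.cong) (simp_all only: eq)
    qed
    then have in0: "kill_prod \<delta> (?y(j := 0)) ?J = kill_prod \<delta> \<mu> (I - {i})"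
      using kill_prod_restrict[of ?J "I - {i}" \<delta> \<mu>] fin by auto
    have yI: "?y k = \<mu> k" if "k \<in> I - {i}" for k using that ij by auto
    have "sum ?y ?J = \<mu> i + sum ?y (I - {i})" using fin ij by simp
    also have "sum ?y (I - {i}) = sum \<mu> (I - {i})" by (rule sum.cong[OF refl yI])
    finally have sumy: "sum ?y ?J = sum \<mu> I" using fin ij by (simp add: sum.remove[of I i])
    have py: "(\<Prod>k\<in>I - {i}. 1 - ?y k / s) = (\<Prod>k\<in>I - {i}. 1 - \<mu> k / s)" for s
      by (rule prod.cong) (simp_all only: yI)
    have "(\<Prod>k\<in>?J. 1 - ?y k / s) = (\<Prod>k\<in>I. 1 - \<mu> k / s)" for s
      using fin ij py[of s] by (simp add: prod.remove[of I i])
    then have iny: "kill_prod \<delta> ?y ?J = kill_prod \<delta> \<mu> I"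
      unfolding kill_prod_def sumy .
    have "min (kill_prod \<delta> (?y(j := 0)) ?J) (kill_prod \<delta> (?y(j := \<mu> j)) ?J) \<le> kill_prod \<delta> ?y ?J"
      using \<delta> fin ij less.prems \<mu> mono[of i j] by (intro kill_prod_unimodal) auto
    then have min: "min (kill_prod \<delta> \<mu> (I - {i})) (kill_prod \<delta> \<mu> ?J) \<le> kill_prod \<delta> \<mu> I"
      unfolding in0 iny by simp
    have S: "?S I = (Suc n - i) + ?S (I - {i})" by (rule sum.remove[OF fin ij(1)])
    have SJ: "?S ?J = (Suc n - j) + ?S (I - {i})" using fin ij by simp
    have "?S (I - {i}) < ?S I" "?S ?J < ?S I" using S SJ ij less.prems by auto
    moreover have "I - {i} \<subseteq> {1..n}" "?J \<subseteq> {1..n}" using less.prems ij by auto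
    ultimately show ?thesis using less.hyps min by (meson min_le_iff_disj order_trans)
  qed
qed

section \<open>Reduction to two-valued variables\<close>

text \<open>The chord conditions say that every slope from the left of the point \<open>(E X, c)\<close> is at most
  every slope to its right. If \<open>E X > 0\<close>, a line through this point therefore lies below the graph of
  \<open>g\<close> on the nonnegative reals; otherwise \<open>X\<close> vanishes almost surely. The case \<open>b = p = 0\<close> is the constant variable.\<close>

lemma expectation_ge_two_point:
  fixes X :: "'a \<Rightarrow> real" and g :: "real \<Rightarrow> real"
  assumes "prob_space M" and Xint: "integrable M X" and X0: "AE \<omega> in M. 0 \<le> X \<omega>"
    and g: "integrable M (\<lambda>\<omega>. g (X \<omega>))"
    and two: "\<And>a b p. 0 \<le> a \<Longrightarrow> 0 \<le> b \<Longrightarrow> 0 \<le> p \<Longrightarrow> p < 1 \<Longrightarrow> a + p * b = integral\<^sup>L M X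
      \<Longrightarrow> c \<le> (1 - p) * g a + p * g (a + b)"
  shows "c \<le> (\<integral>\<omega>. g (X \<omega>) \<partial>M)"
proof -
  interpret prob_space M by fact
  define m where "m = integral\<^sup>L M X"
  have m0: "0 \<le> m" unfolding m_def by (rule Bochner_Integration.integral_nonneg_AE[OF X0])
  have gm: "c \<le> g m" using two[of m 0 0] m0 by (simp add: m_def)
  have slope: "(c - g a) / (m - a) \<le> (g u - c) / (u - m)" if "0 \<le> a" "a < m" "m < u" for a u
  proof -
    have p: "0 \<le> (m - a) / (u - a)" "(m - a) / (u - a) < 1"
      "a + (m - a) / (u - a) * (u - a) = integral\<^sup>L M X"
      using that by (auto simp: m_def)
    have "c \<le> (1 - (m - a) / (u - a)) * g a + (m - a) / (u - a) * g (a + (u - a))"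
      using that by (intro two p) auto
    also have "1 - (m - a) / (u - a) = (u - m) / (u - a)" using that by (simp add: field_simps)
    finally have "c \<le> ((u - m) * g a + (m - a) * g u) / (u - a)"
      by (simp add: add_divide_distrib)
    then have "c * (u - a) \<le> (u - m) * g a + (m - a) * g u"
      using that by (simp add: pos_le_divide_eq)
    then have "(c - g a) * (u - m) \<le> (g u - c) * (m - a)" by (simp add: algebra_simps)
    then show ?thesis using that by (simp add: divide_simps mult.commute)
  qed
  have "\<exists>k. (\<forall>a. 0 \<le> a \<and> a < m \<longrightarrow> (c - g a) / (m - a) \<le> k)
    \<and> (\<forall>u>m. 0 < m \<longrightarrow> k \<le> (g u - c) / (u - m))"
  proof (cases "0 < m")
    case True
    let ?L = "(\<lambda>a. (c - g a) / (m - a)) ` {0..<m}"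
    have bdd: "bdd_above ?L" using slope[of _ "m + 1"] by (intro bdd_aboveI) auto
    have "?L \<noteq> {}" using True by auto
    then show ?thesis
      using cSup_upper[OF _ bdd] slope by (intro exI[of _ "Sup ?L"]) (auto intro!: cSup_least)
  qed auto
  then obtain k where k: "\<And>a. 0 \<le> a \<Longrightarrow> a < m \<Longrightarrow> (c - g a) / (m - a) \<le> k"
    "\<And>u. m < u \<Longrightarrow> 0 < m \<Longrightarrow> k \<le> (g u - c) / (u - m)" by blast
  have line: "c + k * (t - m) \<le> g t" if "0 \<le> t" "0 < m \<or> t = m" for t
  proof -
    consider "t < m" | "t = m" | "m < t" by linarith
    then show ?thesis
    proof cases
      case 1 then show ?thesis using k(1)[OF that(1) 1] by (simp add: field_simps)
    next
      case 2 then show ?thesis using gm by simp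
    next
      case 3 then show ?thesis using k(2)[OF 3] that by (simp add: field_simps)
    qed
  qed
  have "AE \<omega> in M. 0 < m \<or> X \<omega> = m"
  proof (cases "0 < m")
    case False
    then have "m = 0" using m0 by simp
    then show ?thesis using integral_nonneg_eq_0_iff_AE[OF Xint X0] by (simp add: m_def)
  qed simp
  then have "AE \<omega> in M. c + k * (X \<omega> - m) \<le> g (X \<omega>)"
    using X0 by eventually_elim (use line in auto)
  then have "(\<integral>\<omega>. c + k * (X \<omega> - m) \<partial>M) \<le> (\<integral>\<omega>. g (X \<omega>) \<partial>M)"
    using Xint g by (intro integral_mono_AE) auto
  moreover have "(\<integral>\<omega>. c + k * (X \<omega> - m) \<partial>M) = c"
    using Xint by (simp add: m_def prob_space)
  ultimately show ?thesis by simp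
qed

lemma (in prob_space) prob_sum_indep:
  fixes X Y :: "'a \<Rightarrow> real"
  assumes ind: "indep_var borel X borel Y"
  shows "integrable M (\<lambda>\<omega>. prob {\<omega>' \<in> space M. Y \<omega>' < u - X \<omega>})"
    "prob {\<omega> \<in> space M. X \<omega> + Y \<omega> < u} = (\<integral>\<omega>. prob {\<omega>' \<in> space M. Y \<omega>' < u - X \<omega>} \<partial>M)"
proof -
  have X[measurable]: "X \<in> borel_measurable M" and Y[measurable]: "Y \<in> borel_measurable M"
    using ind by (auto dest: indep_var_rv1 indep_var_rv2)
  define G where "G t = prob {\<omega> \<in> space M. Y \<omega> < u - t}" for t
  have "mono (\<lambda>t. - G t)"
    unfolding G_def by (auto intro!: monoI finite_measure_mono)
  then have "(\<lambda>t. - G t) \<in> borel_measurable borel" by (rule borel_measurable_mono)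
  then have G[measurable]: "G \<in> borel_measurable borel" using borel_measurable_uminus by force
  have Gb: "0 \<le> G t" "G t \<le> 1" for t by (simp_all add: G_def)
  show int: "integrable M (\<lambda>\<omega>. prob {\<omega>' \<in> space M. Y \<omega>' < u - X \<omega>})"
    unfolding G_def[symmetric]
    by (rule integrable_const_bound[of _ 1]) (use Gb in auto)
  let ?X = "distr M borel X" and ?Y = "distr M borel Y"
  let ?E = "{z :: real \<times> real. fst z + snd z < u}"
  interpret dX: prob_space ?X by (rule prob_space_distr) simp
  interpret dY: prob_space ?Y by (rule prob_space_distr) simp
  have E: "?E \<in> sets (borel \<Otimes>\<^sub>M borel)"
  proof -
    have "?E = {z \<in> space (borel \<Otimes>\<^sub>M borel). fst z + snd z < u}"
      by (simp add: space_pair_measure)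
    also have "\<dots> \<in> sets (borel \<Otimes>\<^sub>M borel)" by measurable
    finally show ?thesis .
  qed
  have "emeasure M {\<omega> \<in> space M. X \<omega> + Y \<omega> < u}
      = emeasure (distr M (borel \<Otimes>\<^sub>M borel) (\<lambda>\<omega>. (X \<omega>, Y \<omega>))) ?E"
    by (subst emeasure_distr[OF _ E]) (auto intro!: arg_cong[where f = "emeasure M"])
  also have "\<dots> = emeasure (?X \<Otimes>\<^sub>M ?Y) ?E"
    using ind unfolding indep_var_distribution_eq by simp
  also have "\<dots> = (\<integral>\<^sup>+x. emeasure ?Y (Pair x -` ?E) \<partial>?X)"
    by (rule dY.emeasure_pair_measure_alt) (use E in simp)
  also have "\<dots> = (\<integral>\<^sup>+x. ennreal (G x) \<partial>?X)"
  proof (rule nn_integral_cong)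
    fix x
    have "emeasure ?Y (Pair x -` ?E) = emeasure M {\<omega> \<in> space M. Y \<omega> < u - x}"
      by (subst emeasure_distr)
         (auto intro!: arg_cong[where f = "emeasure M"] simp: sets_Pair1 E)
    then show "emeasure ?Y (Pair x -` ?E) = ennreal (G x)"
      by (simp add: G_def emeasure_eq_measure)
  qed
  also have "\<dots> = (\<integral>\<^sup>+\<omega>. ennreal (G (X \<omega>)) \<partial>M)"
    by (subst nn_integral_distr) auto
  also have "\<dots> = ennreal (\<integral>\<omega>. G (X \<omega>) \<partial>M)"
    using int Gb by (intro nn_integral_eq_integral) (auto simp: G_def)
  finally show "prob {\<omega> \<in> space M. X \<omega> + Y \<omega> < u}
      = (\<integral>\<omega>. prob {\<omega>' \<in> space M. Y \<omega>' < u - X \<omega>} \<partial>M)"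
    using Gb by (simp add: G_def emeasure_eq_measure)
qed

text \<open>The variables are exchanged for two-valued ones one at a time. For fixed distributions of the
  others, \<open>P(\<Sum>i\<in>N. X i < L)\<close> is the expectation of a function of a single \<open>X i\<close>, to which the
  preceding lemmas apply. In the intermediate functional \<open>V K\<close> the variables with index in \<open>K\<close> take
  the values \<open>a i\<close> and \<open>a i + b i\<close>, and the others are the original ones.\<close>

lemma prob_ge_two_point:
  fixes X :: "'i \<Rightarrow> 'a \<Rightarrow> real"
  assumes prob: "prob_space M" and fin: "finite N"
    and ind: "prob_space.indep_vars M (\<lambda>_. borel) X N"
    and X0: "\<And>i. i \<in> N \<Longrightarrow> AE \<omega> in M. 0 \<le> X i \<omega>"
    and Xint: "\<And>i. i \<in> N \<Longrightarrow> integrable M (X i)"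
    and Xmu: "\<And>i. i \<in> N \<Longrightarrow> integral\<^sup>L M (X i) = \<mu> i"
    and two: "\<And>a b p. (\<And>i. i \<in> N \<Longrightarrow> 0 \<le> a i \<and> 0 \<le> b i \<and> 0 \<le> p i \<and> p i < 1
        \<and> a i + p i * b i = \<mu> i) \<Longrightarrow> c \<le> below p b (L - sum a N) N"
  shows "c \<le> measure M {\<omega> \<in> space M. (\<Sum>i\<in>N. X i \<omega>) < L}"
proof -
  interpret prob_space M by fact
  define V where "V K a b p = bexp p K (\<lambda>A. prob {\<omega> \<in> space M.
      (\<Sum>i\<in>N - K. X i \<omega>) < L - sum a K - sum b A})" for K a b p
  define ok where "ok K a b p \<longleftrightarrow> (\<forall>i\<in>K. 0 \<le> a i \<and> 0 \<le> b i \<and> 0 \<le> p i \<and> p i < 1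
        \<and> a i + p i * b i = \<mu> i)" for K :: "'i set" and a b p
  have step: "c \<le> V K a b p"
    if K: "K \<subseteq> N" "i \<in> N - K" "ok K a b p"
      and hyp: "\<And>a b p. ok (insert i K) a b p \<Longrightarrow> c \<le> V (insert i K) a b p" for K i a b p
  proof -
    let ?Y = "\<lambda>\<omega>. \<Sum>j\<in>N - insert i K. X j \<omega>"
    have fK: "finite K" using K fin finite_subset by blast
    have iK: "i \<notin> K" using K by simp
    have NK: "N - K = insert i (N - insert i K)" using K by auto
    have iv: "indep_var borel (X i) borel ?Y"
      using fin K by (intro indep_vars_sum indep_vars_subset[OF ind]) auto
    define Pr where "Pr A t = prob {\<omega> \<in> space M. ?Y \<omega> < L - sum a K - sum b A - t}" for A t
    define g where "g t = bexp p K (\<lambda>A. Pr A t)" for t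
    have PrX: "prob {\<omega> \<in> space M. (\<Sum>j\<in>N - K. X j \<omega>) < L - sum a K - sum b A}
        = (\<integral>\<omega>. Pr A (X i \<omega>) \<partial>M)" for A
      unfolding NK Pr_def using prob_sum_indep(2)[OF iv] fin by simp
    have Print: "integrable M (\<lambda>\<omega>. Pr A (X i \<omega>))" for A
      unfolding Pr_def using prob_sum_indep(1)[OF iv] by simp
    have Vg: "V K a b p = (\<integral>\<omega>. g (X i \<omega>) \<partial>M)"
      unfolding V_def PrX g_def bexp_def
      using Print by (subst Bochner_Integration.integral_sum) auto
    have "c \<le> (\<integral>\<omega>. g (X i \<omega>) \<partial>M)"
    proof (rule expectation_ge_two_point[where X = "X i" and g = g, OF prob])
      show "integrable M (\<lambda>\<omega>. g (X i \<omega>))"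
        unfolding g_def bexp_def using Print by auto
      fix a' b' p' :: real
      assume ap: "0 \<le> a'" "0 \<le> b'" "0 \<le> p'" "p' < 1" "a' + p' * b' = integral\<^sup>L M (X i)"
      let ?a = "a(i := a')" and ?b = "b(i := b')" and ?p = "p(i := p')"
      have "ok (insert i K) ?a ?b ?p" using K ap Xmu[of i] by (auto simp: ok_def)
      then have "c \<le> V (insert i K) ?a ?b ?p" by (rule hyp)
      also have "\<dots> = (1 - p') * g a' + p' * g (a' + b')"
      proof -
        have sa: "sum ?a (insert i K) = a' + sum a K"
          using K fK by (simp add: sum.insert) (auto intro!: sum.cong)
        have sb: "sum ?b A = sum b A" "sum ?b (insert i A) = b' + sum b A" if "A \<subseteq> K" for A
        proof -
          have "i \<notin> A" "finite A" using that K fK finite_subset by auto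
          then show "sum ?b A = sum b A" "sum ?b (insert i A) = b' + sum b A"
            by (auto intro!: sum.cong)
        qed
        have pc: "bexp ?p K F = bexp p K F" for F
          unfolding bexp_def using K
          by (intro sum.cong refl arg_cong2[where f = "(*)"] prod.cong) auto
        have 1: "bexp p K (\<lambda>A. prob {\<omega> \<in> space M. ?Y \<omega> < L - sum ?a (insert i K) - sum ?b A})
            = g a'"
          unfolding g_def Pr_def sa
          by (rule bexp_cong) (simp add: sb(1) algebra_simps del: fun_upd_apply)
        have 2: "bexp p K (\<lambda>A. prob {\<omega> \<in> space M.
            ?Y \<omega> < L - sum ?a (insert i K) - sum ?b (insert i A)}) = g (a' + b')"
          unfolding g_def Pr_def sa
          by (rule bexp_cong) (simp add: sb(2) algebra_simps del: fun_upd_apply)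
        show ?thesis
          unfolding V_def bexp_insert[OF fK iK] pc 1 2 by simp
      qed
      finally show "c \<le> (1 - p') * g a' + p' * g (a' + b')" .
    qed (use X0 Xint K in auto)
    then show ?thesis using Vg by simp
  qed
  have full: "c \<le> V N a b p" if "ok N a b p" for a b p
  proof -
    have "c \<le> below p b (L - sum a N) N" using that by (intro two) (auto simp: ok_def)
    also have "\<dots> = V N a b p"
      unfolding below_def V_def by (rule bexp_cong) (auto simp: prob_space)
    finally show ?thesis .
  qed
  have "c \<le> V (N - J) a b p" if "finite J" "J \<subseteq> N" "ok (N - J) a b p" for J a b p
    using that
  proof (induction J arbitrary: a b p)
    case empty
    then show ?case using full by simp
  next
    case (insert i J)
    have eq: "insert i (N - insert i J) = N - J" using insert.hyps insert.prems by auto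
    show ?case
    proof (rule step[of _ i])
      fix a b p
      assume "ok (insert i (N - insert i J)) a b p"
      then show "c \<le> V (insert i (N - insert i J)) a b p"
        unfolding eq using insert.prems by (intro insert.IH) auto
    qed (use insert.prems in auto)
  qed
  from this[of N] have "c \<le> V {} (\<lambda>_. 0) (\<lambda>_. 0) (\<lambda>_. 0)" using fin by (simp add: ok_def)
  then show ?thesis by (simp add: V_def)
qed

section \<open>The inequality for general variables\<close>

theorem mainTheorem1:
  fixes M :: "'a measure" and X :: "nat \<Rightarrow> 'a \<Rightarrow> real"
    and \<mu> :: "nat \<Rightarrow> real" and \<delta> :: real and n :: nat
  assumes "prob_space M"
    and "n \<ge> 1"
    and "0 \<le> \<mu> 1"
    and "\<And>i. i \<in> {1..<n} \<Longrightarrow> \<mu> i \<le> \<mu> (Suc i)"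
    and "prob_space.indep_vars M (\<lambda>_. borel) X {1..n}"
    and "\<And>i. i \<in> {1..n} \<Longrightarrow> (AE \<omega> in M. 0 \<le> X i \<omega>)"
    and "\<And>i. i \<in> {1..n} \<Longrightarrow> integrable M (X i)"
    and "\<And>i. i \<in> {1..n} \<Longrightarrow> integral\<^sup>L M (X i) = \<mu> i"
    and "\<delta> > 0"
  shows "measure M {\<omega> \<in> space M. (\<Sum>i=1..n. X i \<omega>) < \<delta> + (\<Sum>i=1..n. \<mu> i)}
       \<ge> (MIN i\<in>{1..n}. \<Prod>j=i..n. 1 - \<mu> j / (\<delta> + (\<Sum>k=i..n. \<mu> k)))"
proof -
  let ?N = "{1..n}"
  let ?c = "MIN i\<in>?N. \<Prod>j=i..n. 1 - \<mu> j / (\<delta> + (\<Sum>k=i..n. \<mu> k))"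
  have mono: "\<mu> i \<le> \<mu> j" if "1 \<le> i" "i \<le> j" "j \<le> n" for i j
    using that(2,3)
  proof (induction j rule: dec_induct)
    case (step j)
    then show ?case using assms(4)[of j] that(1) by fastforce
  qed simp
  have \<mu>0: "0 \<le> \<mu> i" if "i \<in> ?N" for i using mono[of 1 i] assms(3) that by fastforce
  have "?c \<le> measure M {\<omega> \<in> space M. (\<Sum>i\<in>?N. X i \<omega>) < \<delta> + (\<Sum>i\<in>?N. \<mu> i)}"
  proof (rule prob_ge_two_point[OF assms(1) _ assms(5) assms(6) assms(7) assms(8)])
    fix a b p :: "nat \<Rightarrow> real"
    assume abp: "\<And>i. i \<in> ?N \<Longrightarrow> 0 \<le> a i \<and> 0 \<le> b i \<and> 0 \<le> p i \<and> p i < 1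
        \<and> a i + p i * b i = \<mu> i"
    let ?T = "\<delta> + (\<Sum>i\<in>?N. \<mu> i) - sum a ?N"
    have "(\<Sum>i\<in>?N. \<mu> i) = (\<Sum>i\<in>?N. a i + p i * b i)" using abp by (intro sum.cong) auto
    then have T: "?T = \<delta> + (\<Sum>i\<in>?N. p i * b i)" by (simp add: sum.distrib)
    have "\<exists>y. (\<forall>i\<in>?N. 0 \<le> y i \<and> y i \<le> p i * b i) \<and> kill_prod \<delta> y ?N \<le> below p b ?T ?N"
      by (rule below_ge_prod[OF _ _ _ assms(9) T]) (use abp in auto)
    then obtain y where y: "\<And>i. i \<in> ?N \<Longrightarrow> 0 \<le> y i \<and> y i \<le> p i * b i"
      and le: "kill_prod \<delta> y ?N \<le> below p b ?T ?N" by blast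
    have y\<mu>: "0 \<le> y i \<and> y i \<le> \<mu> i" if "i \<in> ?N" for i
      using y[OF that] abp[OF that] by linarith
    obtain I where I: "I \<subseteq> ?N" "kill_prod \<delta> \<mu> I \<le> kill_prod \<delta> y ?N"
      using kill_prod_ge_subset[where N = ?N and y = y and \<mu> = \<mu>, OF finite_atLeastAtMost assms(9) y\<mu>]
      by auto
    obtain i where i: "i \<in> ?N" "kill_prod \<delta> \<mu> {i..n} \<le> kill_prod \<delta> \<mu> I"
      using kill_prod_ge_suffix[where n = n and \<mu> = \<mu>, OF assms(2) assms(9) \<mu>0 mono I(1)] by auto
    have "?c \<le> kill_prod \<delta> \<mu> {i..n}"
      unfolding kill_prod_def using i(1) by (intro Min_le) auto
    then show "?c \<le> below p b ?T ?N" using i(2) I(2) le by linarith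
  qed auto
  then show ?thesis .
qed

end
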